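(* Let $a>b>0$, $c=\sqrt{a^2-b^2}$, $t_0\in\mathbb{R}$, and $$f(t)=\frac{b(a-c\cos t)}{\sqrt{a^2-c^2\cos^2 t}},\qquad g(t)=\int_{t_0}^t\sqrt{a^2-c^2\cos^2 z}\,dz-\frac{c\sin t\,(a-c\cos t)}{\sqrt{a^2-c^2\cos^2 t}}.$$ Consider the unduloid $\mathbf{y}(t,v)=(f(t)\cos v,\,f(t)\sin v,\,g(t))$. With $h(t)=\dfrac{ab}{\sqrt{a^2-c^2\cos^2 t}\,(a+c\cos t)}$ one has $$\mathbf{y}_t=\big(c\sin t\,h(t)\cos v,\;c\sin t\,h(t)\sin v,\;b\,h(t)\big),\qquad \mathbf{y}_v=(-f(t)\sin v,\,f(t)\cos v,\,0),$$ and the unit normal is $$\mathbf{n}(t,v)=\frac{1}{\sqrt{a^2-c^2\cos^2 t}}\,(-b\cos v,\,-b\sin v,\,c\sin t).$$ The non-vanishing coefficients of the fundamental forms are $$E=\frac{a^2b^2}{(a+c\cos t)^2},\quad G=\frac{b^2(a-c\cos t)}{a+c\cos t},\quad L=\frac{-ab^2c\cos t}{(a^2-c^2\cos^2 t)(a+c\cos t)},\quad N=\frac{b^2}{a+c\cos t},$$ and the principal, mean and Gaussian curvatures are $$k_1=\frac{-c\cos t}{a(a-c\cos t)},\quad k_2=\frac{1}{a-c\cos t},\quad H=\frac{1}{2a},\quad K=\frac{-c\cos t}{a(a-c\cos t)^2}.$$ In particular the mean curvature is constant, equal to the inverse of the distance $2a$ between the vertices of the ellipse with semi-axes $a,b$.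 The geodesic curvature of the parallel at parameter $t$ is $k_g(t)=\dfrac{c\sin t}{b(a-c\cos t)}$. For $t_1<t_2$ and $v_1<v_2$, the total curvature over $[t_1,t_2]\times[v_1,v_2]$ is $$\int_{\mathbf{y}}K\,d\sigma=-c(v_2-v_1)\left.\frac{\sin t}{\sqrt{a^2-c^2\cos^2 t}}\right|_{t=t_1}^{t=t_2}.$$
   Context: For a surface of revolution $\mathbf{x}(t,v)=(f(t)\cos v,f(t)\sin v,g(t))$ with $f>0$, the unit normal is $\mathbf{n}=\frac{\mathbf{x}_t\times\mathbf{x}_v}{|\mathbf{x}_t\times\mathbf{x}_v|}$, and $E=\langle\mathbf{x}_t,\mathbf{x}_t\rangle$, $F=\langle\mathbf{x}_t,\mathbf{x}_v\rangle$, $G=\langle\mathbf{x}_v,\mathbf{x}_v\rangle$, $L=\langle\mathbf{x}_{tt},\mathbf{n}\rangle$, $M=\langle\mathbf{x}_{tv},\mathbf{n}\rangle$, $N=\langle\mathbf{x}_{vv},\mathbf{n}\rangle$. The principal curvatures are $k_1=L/E$, $k_2=N/G$, the mean curvature is $H=(k_1+k_2)/2$, and the Gaussian curvature is $K=LN/(EG)$. The geodesic curvature of an arc-length parametrized curve $\alpha$ in the surface is $k_g=\langle\alpha'',\mathbf{u}\rangle$, where $\mathbf{u}$ is the unit tangent vector to the surface with $\alpha'\times\mathbf{u}=\mathbf{n}$; the parallel at parameter $t$ is the curve $v\mapsto\mathbf{x}(t,v)$ traversed with $v$ increasing. The area element is $d\sigma=|\mathbf{x}_t|\,|\mathbf{x}_v|\,dt\,dv$.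 *)

theory Defs
  imports "HOL-Analysis.Analysis"
begin

text \<open>
  A parametrized surface is a curried map of the parameters \<open>t\<close> and \<open>v\<close> into \<open>real ^ 3\<close>.
  The iterated application \<open>d_v (d_t x)\<close> is \<open>x_tv\<close>, i.e. \<open>d_t\<close> is taken first.
\<close>

type_synonym surface = "real \<Rightarrow> real \<Rightarrow> real ^ 3"

definition d_t :: "surface \<Rightarrow> surface" where
  "d_t x t v = vector_derivative (\<lambda>s. x s v) (at t)"

definition d_v :: "surface \<Rightarrow> surface" where
  "d_v x t v = vector_derivative (\<lambda>w. x t w) (at v)"

definition surface_of_revolution :: "(real \<Rightarrow> real) \<Rightarrow> (real \<Rightarrow> real) \<Rightarrow> surface" where
  "surface_of_revolution f g t v = vector [f t * cos v, f t * sin v, g t]"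

definition unit_normal :: "surface \<Rightarrow> surface" where
  "unit_normal x t v =
     cross3 (d_t x t v) (d_v x t v) /\<^sub>R norm (cross3 (d_t x t v) (d_v x t v))"

definition coeff_E :: "surface \<Rightarrow> real \<Rightarrow> real \<Rightarrow> real" where
  "coeff_E x t v = d_t x t v \<bullet> d_t x t v"

definition coeff_F :: "surface \<Rightarrow> real \<Rightarrow> real \<Rightarrow> real" where
  "coeff_F x t v = d_t x t v \<bullet> d_v x t v"

definition coeff_G :: "surface \<Rightarrow> real \<Rightarrow> real \<Rightarrow> real" where
  "coeff_G x t v = d_v x t v \<bullet> d_v x t v"

definition coeff_L :: "surface \<Rightarrow> real \<Rightarrow> real \<Rightarrow> real" where
  "coeff_L x t v = d_t (d_t x) t v \<bullet> unit_normal x t v"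

definition coeff_M :: "surface \<Rightarrow> real \<Rightarrow> real \<Rightarrow> real" where
  "coeff_M x t v = d_v (d_t x) t v \<bullet> unit_normal x t v"

definition coeff_N :: "surface \<Rightarrow> real \<Rightarrow> real \<Rightarrow> real" where
  "coeff_N x t v = d_v (d_v x) t v \<bullet> unit_normal x t v"

text \<open>
  The four curvatures below are given by the formulas valid when \<open>F = M = 0\<close>, as is the case
  for every surface of revolution; they are not the general formulas.
\<close>

definition principal_curvature1 :: "surface \<Rightarrow> real \<Rightarrow> real \<Rightarrow> real" where
  "principal_curvature1 x t v = coeff_L x t v / coeff_E x t v"

definition principal_curvature2 :: "surface \<Rightarrow> real \<Rightarrow> real \<Rightarrow> real" where
  "principal_curvature2 x t v = coeff_N x t v / coeff_G x t v"

definition mean_curvature :: "surface \<Rightarrow> real \<Rightarrow> real \<Rightarrow> real" where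
  "mean_curvature x t v = (principal_curvature1 x t v + principal_curvature2 x t v) / 2"

definition gaussian_curvature :: "surface \<Rightarrow> real \<Rightarrow> real \<Rightarrow> real" where
  "gaussian_curvature x t v =
     (coeff_L x t v * coeff_N x t v) / (coeff_E x t v * coeff_G x t v)"

text \<open>
  A curve in the surface is given by its parameters: \<open>\<alpha> s = x (\<tau> s) (\<nu> s)\<close>.
  The definition is meaningful only if \<open>\<alpha>\<close> has unit speed; then the vector \<open>u\<close> is unique.
\<close>

definition geodesic_curvature ::
  "surface \<Rightarrow> (real \<Rightarrow> real) \<Rightarrow> (real \<Rightarrow> real) \<Rightarrow> real \<Rightarrow> real" where
  "geodesic_curvature x \<tau> \<nu> s =
     (let \<alpha> = (\<lambda>r. x (\<tau> r) (\<nu> r));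
          \<alpha>' = (\<lambda>r. vector_derivative \<alpha> (at r));
          \<alpha>'' = vector_derivative \<alpha>' (at s);
          u = (THE u. norm u = 1 \<and> u \<in> span {d_t x (\<tau> s) (\<nu> s), d_v x (\<tau> s) (\<nu> s)} \<and>
                      cross3 (\<alpha>' s) u = unit_normal x (\<tau> s) (\<nu> s))
      in \<alpha>'' \<bullet> u)"

text \<open>\<open>\<phi>\<close> is an orientation preserving change of parameter making \<open>\<gamma>\<close> a unit speed curve.\<close>

definition arc_length_reparam :: "(real \<Rightarrow> real ^ 3) \<Rightarrow> (real \<Rightarrow> real) \<Rightarrow> bool" where
  "arc_length_reparam \<gamma> \<phi> \<longleftrightarrow>
     strict_mono \<phi> \<and> (\<forall>s. \<phi> differentiable at s) \<and>
     (\<forall>s. \<exists>D. ((\<lambda>r. \<gamma> (\<phi> r)) has_vector_derivative D) (at s) \<and> norm D = 1)"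

definition curvature_density :: "surface \<Rightarrow> real \<times> real \<Rightarrow> real" where
  "curvature_density x = (\<lambda>(t, v). gaussian_curvature x t v * (norm (d_t x t v) * norm (d_v x t v)))"

definition total_curvature :: "surface \<Rightarrow> (real \<times> real) set \<Rightarrow> real" where
  "total_curvature x S = set_lebesgue_integral lborel S (curvature_density x)"

definition ellipse :: "real \<Rightarrow> real \<Rightarrow> (real \<times> real) set" where
  "ellipse a b = {(p, q). p\<^sup>2 / a\<^sup>2 + q\<^sup>2 / b\<^sup>2 = 1}"

text \<open>Vertices are the points on the focal axis, which is the first coordinate axis if \<open>a > b\<close>.\<close>

definition ellipse_vertices :: "real \<Rightarrow> real \<Rightarrow> (real \<times> real) set" where
  "ellipse_vertices a b = {P \<in> ellipse a b. snd P = 0}"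

end

theory Submission imports Defs begin

text \<open>
  All coefficients of a surface of revolution are expressed through the profile \<open>(f, g)\<close>, its
  derivatives, and its speed \<open>sqrt (f'\<^sup>2 + g'\<^sup>2)\<close>. Writing \<open>W = sqrt (a\<^sup>2 - c\<^sup>2 cos\<^sup>2 t)\<close>, one has
  \<open>W\<^sup>2 = (a - c cos t) (a + c cos t) = b\<^sup>2 + c\<^sup>2 sin\<^sup>2 t\<close>; hence the profile of the unduloid satisfies
  \<open>f' = c sin t h\<close> and \<open>g' = b h\<close> and has speed \<open>h W\<close>. The curvature density reduces to
  \<open>- c b\<^sup>2 cos t / W\<^sup>3\<close>, the derivative of \<open>- c sin t / W\<close>, and depends on \<open>t\<close> only.
\<close>

section \<open>Coordinate calculus in three-dimensional space\<close>

lemma has_vector_derivative_vector_3: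
  fixes p q r :: "real \<Rightarrow> real"
  assumes "(p has_real_derivative p') (at x within S)" "(q has_real_derivative q') (at x within S)"
    "(r has_real_derivative r') (at x within S)"
  shows "((\<lambda>s. vector [p s, q s, r s] :: real ^ 3) has_vector_derivative vector [p', q', r'])
    (at x within S)"
proof -
  \<comment> \<open>In the standard basis the curve is a sum of scalar functions times constant
    vectors, to which the sum and scaling rules for derivatives apply.\<close>
  have vector_axes: "(vector [x, y, z] :: real ^ 3) =
      x *\<^sub>R axis 1 1 + y *\<^sub>R axis 2 1 + z *\<^sub>R axis 3 1" for x y z :: real
    by (simp add: vec_eq_iff forall_3 axis_def)
  have "((\<lambda>s. k s *\<^sub>R A) has_vector_derivative k' *\<^sub>R A) (at x within S)"
    if "(k has_real_derivative k') (at x within S)" for k k' and A :: "real ^ 3"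
    using has_vector_derivative_scaleR[OF that has_vector_derivative_const[of A]] by simp
  then show ?thesis
    unfolding vector_axes using assms by (intro has_vector_derivative_add)
qed

lemma inner_vector_3:
  "(vector [x, y, z] :: real ^ 3) \<bullet> vector [x', y', z'] = x * x' + y * y' + z * z'"
  by (simp add: inner_vec_def sum_3)

lemma cross3_vector_3:
  "cross3 (vector [x, y, z]) (vector [x', y', z']) =
     vector [y * z' - z * y', z * x' - x * z', x * y' - y * x']"
  by (simp add: cross3_def)

lemma scaleR_vector_3:
  "k *\<^sub>R (vector [x, y, z] :: real ^ 3) = vector [k * x, k * y, k * z]"
  by (simp add: vec_eq_iff forall_3)

lemma norm_vector_3: "norm (vector [x, y, z] :: real ^ 3) = sqrt (x\<^sup>2 + y\<^sup>2 + z\<^sup>2)"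
  by (simp add: norm_eq_sqrt_inner inner_vector_3 power2_eq_square)

text \<open>By the norm identity for cross products, a unit product of unit vectors forces
  \<open>e \<bullet> u = 0\<close>. Then \<open>cross3 e (cross3 e u) = - u\<close> by Lagrange, so
  \<open>u\<close> can be recovered from \<open>n\<close> and \<open>e\<close>. This determines the
  vector chosen by \<open>THE\<close> in \<open>geodesic_curvature\<close>.\<close>

lemma cross3_right_unique:
  fixes e n u :: "real ^ 3"
  assumes e: "norm e = 1" and u: "norm u = 1" and n: "cross3 e u = n" "norm n = 1"
  shows "u = cross3 n e"
proof -
  have "(norm (cross3 e u))\<^sup>2 = (norm e)\<^sup>2 * (norm u)\<^sup>2 - (e \<bullet> u)\<^sup>2"
    by (rule norm_cross)
  then have "e \<bullet> u = 0"
    using e u n by simp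
  moreover have "cross3 n e = - cross3 e (cross3 e u)"
    using cross_skew[of n e] n by simp
  moreover have "e \<bullet> e = 1"
    using e by (simp add: dot_square_norm)
  ultimately show ?thesis
    by (simp add: Lagrange)
qed

text \<open>The Pythagorean identity, in the nested shape that products of coordinate vectors take
  after algebraic normalization.\<close>

lemma cos_sin_mult:
  fixes k :: real
  shows "cos v * (cos v * k) + sin v * (sin v * k) = k"
proof -
  have "cos v * (cos v * k) + sin v * (sin v * k) = ((cos v)\<^sup>2 + (sin v)\<^sup>2) * k"
    by (simp only: power2_eq_square distrib_right mult.assoc)
  then show ?thesis by simp
qed

section \<open>Fundamental forms of a surface of revolution with regular profile\<close>

locale revolution =
  fixes f g f' g' f'' g'' :: "real \<Rightarrow> real"
  assumes f_deriv: "\<And>t. (f has_real_derivative f' t) (at t)"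
    and g_deriv: "\<And>t. (g has_real_derivative g' t) (at t)"
    and f'_deriv: "\<And>t. (f' has_real_derivative f'' t) (at t)"
    and g'_deriv: "\<And>t. (g' has_real_derivative g'' t) (at t)"
    and f_pos: "\<And>t. f t > 0"
    and regular: "\<And>t. (f' t)\<^sup>2 + (g' t)\<^sup>2 > 0"
begin

abbreviation X :: surface where "X \<equiv> surface_of_revolution f g"

lemma has_vector_derivative_t:
  "((\<lambda>s. X s v) has_vector_derivative vector [f' t * cos v, f' t * sin v, g' t]) (at t)"
  unfolding surface_of_revolution_def
  by (rule has_vector_derivative_vector_3) (auto intro!: derivative_eq_intros f_deriv g_deriv)

lemma has_vector_derivative_v:
  "((\<lambda>w. X t w) has_vector_derivative vector [- f t * sin v, f t * cos v, 0]) (at v)"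
  unfolding surface_of_revolution_def
  by (rule has_vector_derivative_vector_3) (auto intro!: derivative_eq_intros)

lemma d_t: "d_t X = (\<lambda>t v. vector [f' t * cos v, f' t * sin v, g' t])"
  unfolding d_t_def using has_vector_derivative_t by (auto intro!: ext vector_derivative_at)

lemma d_v: "d_v X = (\<lambda>t v. vector [- f t * sin v, f t * cos v, 0])"
  unfolding d_v_def using has_vector_derivative_v by (auto intro!: ext vector_derivative_at)

lemma d_t_d_t: "d_t (d_t X) t v = vector [f'' t * cos v, f'' t * sin v, g'' t]"
  unfolding d_t unfolding d_t_def
  by (intro vector_derivative_at has_vector_derivative_vector_3)
    (auto intro!: derivative_eq_intros f'_deriv g'_deriv)

lemma d_v_d_t: "d_v (d_t X) t v = vector [- f' t * sin v, f' t * cos v, 0]"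
  unfolding d_t d_v_def
  by (intro vector_derivative_at has_vector_derivative_vector_3)
    (auto intro!: derivative_eq_intros)

lemma d_v_d_v: "d_v (d_v X) t v = vector [- f t * cos v, - f t * sin v, 0]"
  unfolding d_v unfolding d_v_def
  by (intro vector_derivative_at has_vector_derivative_vector_3)
    (auto intro!: derivative_eq_intros)

definition speed :: "real \<Rightarrow> real" where "speed t = sqrt ((f' t)\<^sup>2 + (g' t)\<^sup>2)"

lemma speed_pos: "speed t > 0"
  using regular[of t] by (simp add: speed_def)

lemma norm_d_t: "norm (d_t X t v) = speed t"
  by (simp add: d_t speed_def norm_vector_3 power_mult_distrib sin_squared_eq algebra_simps)

lemma norm_d_v: "norm (d_v X t v) = f t"
  using f_pos[of t]
  by (simp add: d_v norm_vector_3 power_mult_distrib sin_squared_eq algebra_simps)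

lemma coeff_F: "coeff_F X t v = 0"
  by (simp add: coeff_F_def d_t d_v inner_vector_3)

text \<open>Since F = 0, the norm of the cross product is the product of the norms,
  \<open>speed t * f t\<close>. The cross product itself carries the factor \<open>f t\<close>,
  which cancels.\<close>

lemma unit_normal:
  "unit_normal X t v = (1 / speed t) *\<^sub>R vector [- g' t * cos v, - g' t * sin v, f' t]"
proof -
  have "(norm (cross3 (d_t X t v) (d_v X t v)))\<^sup>2 = (speed t * f t)\<^sup>2"
    using coeff_F[of t v] by (simp add: norm_cross coeff_F_def norm_d_t norm_d_v power_mult_distrib)
  then have norm: "norm (cross3 (d_t X t v) (d_v X t v)) = speed t * f t"
    using speed_pos[of t] f_pos[of t] by (simp add: power2_eq_iff_nonneg)
  have cross: "cross3 (d_t X t v) (d_v X t v) =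
      f t *\<^sub>R vector [- g' t * cos v, - g' t * sin v, f' t]"
    by (simp add: d_t d_v cross3_vector_3 scaleR_vector_3 algebra_simps cos_sin_mult)
  show ?thesis
    unfolding unit_normal_def norm unfolding cross using f_pos[of t] by (simp add: divide_simps)
qed

lemma coeff_E: "coeff_E X t v = (speed t)\<^sup>2"
  by (simp add: coeff_E_def dot_square_norm norm_d_t)

lemma coeff_G: "coeff_G X t v = (f t)\<^sup>2"
  by (simp add: coeff_G_def dot_square_norm norm_d_v)

lemma coeff_L: "coeff_L X t v = (f' t * g'' t - f'' t * g' t) / speed t"
proof -
  have "vector [f'' t * cos v, f'' t * sin v, g'' t] \<bullet>
      (vector [- g' t * cos v, - g' t * sin v, f' t] :: real ^ 3) = f' t * g'' t - f'' t * g' t"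
    by (simp add: inner_vector_3 algebra_simps cos_sin_mult)
  then show ?thesis
    by (simp add: coeff_L_def d_t_d_t unit_normal)
qed

lemma coeff_M: "coeff_M X t v = 0"
  by (simp add: coeff_M_def d_v_d_t unit_normal inner_vector_3)

lemma coeff_N: "coeff_N X t v = f t * g' t / speed t"
proof -
  have "vector [- f t * cos v, - f t * sin v, 0] \<bullet>
      (vector [- g' t * cos v, - g' t * sin v, f' t] :: real ^ 3) = f t * g' t"
    by (simp add: inner_vector_3 algebra_simps cos_sin_mult)
  then show ?thesis
    by (simp add: coeff_N_def d_v_d_v unit_normal)
qed

lemma norm_unit_normal: "norm (unit_normal X t v) = 1"
proof -
  have "norm (vector [- g' t * cos v, - g' t * sin v, f' t] :: real ^ 3) = speed t"
    by (simp add: speed_def norm_vector_3 power_mult_distrib sin_squared_eq algebra_simps)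
  then show ?thesis
    using speed_pos[of t] by (simp add: unit_normal)
qed

section \<open>Parallels by arc length and their geodesic curvature\<close>

lemma has_vector_derivative_parallel:
  assumes "(\<phi> has_real_derivative D) (at s)"
  shows "((\<lambda>r. X t (\<phi> r)) has_vector_derivative D *\<^sub>R d_v X t (\<phi> s)) (at s)"
  using vector_diff_chain_at[of \<phi> D s "X t"] assms has_vector_derivative_v[of t "\<phi> s"]
  by (simp add: d_v o_def has_real_derivative_iff_has_vector_derivative)

text \<open>The tangent \<open>d_v X\<close> has length \<open>f t\<close>, so unit speed gives
  \<open>\<bar>D\<bar> * f t = 1\<close>, and monotonicity settles the sign. Thus every admissible
  reparametrization has the same constant derivative.\<close>

lemma parallel_reparam_deriv:
  assumes "arc_length_reparam (X t) \<phi>"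
  shows "(\<phi> has_real_derivative 1 / f t) (at s)"
proof -
  from assms have "\<phi> differentiable at s"
    by (simp add: arc_length_reparam_def)
  then obtain D where D: "(\<phi> has_real_derivative D) (at s)"
    by (auto simp: real_differentiable_def)
  have "mono \<phi>"
    using assms by (simp add: arc_length_reparam_def strict_mono_mono)
  \<comment> \<open>Strict monotonicity alone yields only the weak inequality; \<open>D = 0\<close>
    is ruled out below by unit speed.\<close>
  then have "D \<ge> 0"
    using mono_on_imp_deriv_nonneg[of UNIV \<phi> D s] D by simp
  have "((\<lambda>r. X t (\<phi> r)) has_vector_derivative D *\<^sub>R d_v X t (\<phi> s)) (at s)"
    using D by (rule has_vector_derivative_parallel)
  moreover obtain V where "((\<lambda>r. X t (\<phi> r)) has_vector_derivative V) (at s)" "norm V = 1"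
    using assms by (auto simp: arc_length_reparam_def)
  ultimately have "norm (D *\<^sub>R d_v X t (\<phi> s)) = 1"
    using vector_derivative_unique_at by metis
  then have "D * f t = 1"
    using \<open>D \<ge> 0\<close> by (simp add: norm_d_v)
  then have "D = 1 / f t"
    using f_pos[of t] by (simp add: field_simps)
  with D show ?thesis by simp
qed

lemma parallel_reparam_exists: "\<exists>\<phi>. arc_length_reparam (X t) \<phi> \<and> surj \<phi>"
proof (intro exI conjI)
  \<comment> \<open>The parallel is a circle of radius \<open>f t\<close>, so arc length
    \<open>s\<close> corresponds to the angle \<open>s / f t\<close>.\<close>
  let ?\<phi> = "\<lambda>s. s / f t"
  have pos: "f t > 0" by (rule f_pos)
  have "((\<lambda>r. X t (?\<phi> r)) has_vector_derivative (1 / f t) *\<^sub>R d_v X t (?\<phi> s)) (at s)" for s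
    using pos by (intro has_vector_derivative_parallel) (auto intro!: derivative_eq_intros)
  moreover have "norm ((1 / f t) *\<^sub>R d_v X t w) = 1" for w
    using pos by (simp add: norm_d_v)
  moreover have "strict_mono ?\<phi>"
    using pos by (auto simp: strict_mono_def divide_strict_right_mono)
  moreover have "?\<phi> differentiable at s" for s
    using pos by (auto intro!: derivative_intros)
  ultimately show "arc_length_reparam (X t) ?\<phi>"
    unfolding arc_length_reparam_def by blast
  show "surj ?\<phi>"
    by (rule surjI[of _ "\<lambda>w. w * f t"]) (use pos in simp)
qed

text \<open>The acceleration of the parallel points towards the axis and has length
  \<open>1 / f t\<close>, while \<open>u\<close> is minus the unit tangent of the profile curve.
  Their inner product is therefore the radial component \<open>f' t / speed t\<close> of that
  tangent, divided by \<open>f t\<close>.\<close>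

lemma geodesic_curvature_parallel:
  assumes \<phi>: "arc_length_reparam (X t) \<phi>"
  shows "geodesic_curvature X (\<lambda>_. t) \<phi> s = f' t / (f t * speed t)"
proof -
  \<comment> \<open>The unit tangent of the parallel at angle \<open>w\<close>.\<close>
  define e where "e = (\<lambda>w. vector [- sin w, cos w, 0] :: real ^ 3)"
  note \<phi>_deriv = parallel_reparam_deriv[OF \<phi>]
  have pos: "f t > 0" "speed t > 0"
    by (rule f_pos) (rule speed_pos)
  have d_v_e: "d_v X t w = f t *\<^sub>R e w" for w
    by (simp add: d_v e_def scaleR_vector_3)
  have \<alpha>': "vector_derivative (\<lambda>r. X t (\<phi> r)) (at r) = e (\<phi> r)" for r
  proof (rule vector_derivative_at)
    show "((\<lambda>r. X t (\<phi> r)) has_vector_derivative e (\<phi> r)) (at r)"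
      using has_vector_derivative_parallel[OF \<phi>_deriv, of t r] pos by (simp add: d_v_e)
  qed
  have \<alpha>'': "vector_derivative (\<lambda>r. e (\<phi> r)) (at s) =
      (1 / f t) *\<^sub>R vector [- cos (\<phi> s), - sin (\<phi> s), 0]"
    unfolding e_def scaleR_vector_3
    by (intro vector_derivative_at has_vector_derivative_vector_3)
      (auto intro!: derivative_eq_intros \<phi>_deriv)
  define n where "n = unit_normal X t (\<phi> s)"
  \<comment> \<open>The normal is the cross product of \<open>d_t X / speed t\<close> with
    \<open>e\<close>, in this order. Exchanging the factors produces the minus sign.\<close>
  define u where "u = (- 1 / speed t) *\<^sub>R d_t X t (\<phi> s)"
  have norm_e: "norm (e w) = 1" for w
    by (simp add: e_def norm_vector_3)
  have norm_u: "norm u = 1"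
    using pos by (simp add: u_def norm_d_t)
  have cross: "cross3 (e (\<phi> s)) u = n"
  proof -
    have "- sin (\<phi> s) * (f' t * sin (\<phi> s)) - cos (\<phi> s) * (f' t * cos (\<phi> s)) = - f' t"
      using cos_sin_mult[of "\<phi> s" "f' t"] by (simp add: algebra_simps)
    then have "cross3 (e (\<phi> s)) (d_t X t (\<phi> s)) =
        - 1 *\<^sub>R vector [- g' t * cos (\<phi> s), - g' t * sin (\<phi> s), f' t]"
      unfolding scaleR_vector_3
      by (simp add: e_def d_t cross3_vector_3 mult_ac)
    then show ?thesis
      by (simp add: u_def n_def unit_normal cross_mult_right)
  qed
  have "(THE u. norm u = 1 \<and> u \<in> span {d_t X t (\<phi> s), d_v X t (\<phi> s)} \<and>
      cross3 (e (\<phi> s)) u = n) = u"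
  proof (rule the_equality)
    show "norm u = 1 \<and> u \<in> span {d_t X t (\<phi> s), d_v X t (\<phi> s)} \<and> cross3 (e (\<phi> s)) u = n"
      using norm_u cross unfolding u_def by (blast intro: span_scale span_base)
  next
    fix u'
    assume "norm u' = 1 \<and> u' \<in> span {d_t X t (\<phi> s), d_v X t (\<phi> s)} \<and> cross3 (e (\<phi> s)) u' = n"
    then show "u' = u"
      using cross3_right_unique[OF norm_e, of _ "\<phi> s" n] norm_unit_normal norm_u cross
      unfolding n_def by metis
  qed
  then have "geodesic_curvature X (\<lambda>_. t) \<phi> s =
      ((1 / f t) *\<^sub>R vector [- cos (\<phi> s), - sin (\<phi> s), 0]) \<bullet> u"
    by (simp add: geodesic_curvature_def \<alpha>' \<alpha>'' n_def)
  also have "\<dots> = (cos (\<phi> s) * (cos (\<phi> s) * f' t) + sin (\<phi> s) * (sin (\<phi> s) * f' t)) / (f t * speed t)"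
    using pos by (simp add: u_def d_t inner_vector_3 field_simps)
  finally show ?thesis by (simp only: cos_sin_mult)
qed

end

text \<open>Continuity on a compact rectangle gives integrability. By Fubini the inner integral over
  \<open>v\<close> contributes the length \<open>v2 - v1\<close>, and the fundamental theorem of
  calculus evaluates the outer one.\<close>

lemma set_integral_strip:
  fixes k F :: "real \<Rightarrow> real"
  assumes F: "\<And>t. (F has_real_derivative k t) (at t)" and k: "continuous_on UNIV k"
    and "t1 \<le> t2" "v1 \<le> v2"
  shows "set_integrable lborel ({t1..t2} \<times> {v1..v2}) (\<lambda>p. k (fst p))"
    and "set_lebesgue_integral lborel ({t1..t2} \<times> {v1..v2}) (\<lambda>p. k (fst p)) =
      (v2 - v1) * (F t2 - F t1)"
proof -
  let ?S = "{t1..t2} \<times> {v1..v2}"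
  have "continuous_on ?S (\<lambda>p. k (fst p))"
    by (intro continuous_on_compose2[OF k] continuous_intros) auto
  then show int: "set_integrable lborel ?S (\<lambda>p. k (fst p))"
    unfolding set_integrable_def by (intro borel_integrable_compact compact_Times) auto
  have FTC: "(\<integral>t. indicator {t1..t2} t *\<^sub>R k t \<partial>lborel) = F t2 - F t1"
    using integral_FTC_Icc_real[of t1 t2 F k] \<open>t1 \<le> t2\<close> F k
    by (auto simp: continuous_on_eq_continuous_at mult.commute)
  have "(LINT p:?S|lborel. k (fst p)) =
      (\<integral>t. (\<integral>v. indicator ?S (t, v) *\<^sub>R k t \<partial>lborel) \<partial>lborel)"
    using lborel_pair.integral_fst'[of "\<lambda>p. indicator ?S p *\<^sub>R k (fst p)"] int
    by (simp add: set_integrable_def set_lebesgue_integral_def lborel_prod)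
  also have "\<dots> = (\<integral>t. (indicator {t1..t2} t *\<^sub>R k t) * (v2 - v1) \<partial>lborel)"
    using \<open>v1 \<le> v2\<close> by (simp add: indicator_times mult_ac)
  finally show "(LINT p:?S|lborel. k (fst p)) = (v2 - v1) * (F t2 - F t1)"
    unfolding integral_mult_left_zero FTC by (simp only: mult.commute)
qed

section \<open>The unduloid profile and its derivatives\<close>

locale unduloid =
  fixes a b c t0 :: real and f g h :: "real \<Rightarrow> real"
  assumes b_less: "b < a" and b_pos: "b > 0"
    and c: "c = sqrt (a\<^sup>2 - b\<^sup>2)"
    and f: "f = (\<lambda>t. b * (a - c * cos t) / sqrt (a\<^sup>2 - c\<^sup>2 * (cos t)\<^sup>2))"
    and g: "g = (\<lambda>t. (LBINT z=ereal t0..ereal t. sqrt (a\<^sup>2 - c\<^sup>2 * (cos z)\<^sup>2)) -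
                     c * sin t * (a - c * cos t) / sqrt (a\<^sup>2 - c\<^sup>2 * (cos t)\<^sup>2))"
    and h: "h = (\<lambda>t. a * b / (sqrt (a\<^sup>2 - c\<^sup>2 * (cos t)\<^sup>2) * (a + c * cos t)))"
begin

definition W :: "real \<Rightarrow> real" where "W t = sqrt (a\<^sup>2 - c\<^sup>2 * (cos t)\<^sup>2)"

lemma a_pos: "a > 0"
  using b_less b_pos by simp

lemma b2_less: "b\<^sup>2 < a\<^sup>2"
  using b_less b_pos by (simp add: power_strict_mono)

lemma c_power2: "c\<^sup>2 = a\<^sup>2 - b\<^sup>2"
  using b2_less by (simp add: c)

text \<open>Rests on \<open>c\<^sup>2 = a\<^sup>2 - b\<^sup>2 < a\<^sup>2\<close>. The positivity of
  \<open>a - c * cos t\<close>, \<open>a + c * cos t\<close> and \<open>W t\<close>, and so of every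
  denominator built from them, follows from this.\<close>

lemma abs_c_cos_less: "\<bar>c * cos t\<bar> < a"
proof -
  have "c\<^sup>2 * (cos t)\<^sup>2 \<le> c\<^sup>2"
    by (simp add: mult_left_le abs_square_le_1)
  also have "c\<^sup>2 < a\<^sup>2"
    using b_pos by (simp add: c_power2)
  finally have "(c * cos t)\<^sup>2 < a\<^sup>2"
    by (simp add: power_mult_distrib)
  then show ?thesis
    using a_pos power2_less_imp_less[of "\<bar>c * cos t\<bar>" a] by simp
qed

lemma minus_pos: "a - c * cos t > 0" and plus_pos: "a + c * cos t > 0"
  using abs_c_cos_less[of t] by auto

lemma W_power2: "(W t)\<^sup>2 = a\<^sup>2 - c\<^sup>2 * (cos t)\<^sup>2"
  and W_pos: "W t > 0"
proof -
  have "a\<^sup>2 - c\<^sup>2 * (cos t)\<^sup>2 = (a - c * cos t) * (a + c * cos t)"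
    by (simp add: power2_eq_square algebra_simps)
  then have "a\<^sup>2 - c\<^sup>2 * (cos t)\<^sup>2 > 0"
    using minus_pos plus_pos by simp
  then show "(W t)\<^sup>2 = a\<^sup>2 - c\<^sup>2 * (cos t)\<^sup>2" "W t > 0"
    by (simp_all add: W_def)
qed

lemma W_factor: "(W t)\<^sup>2 = (a - c * cos t) * (a + c * cos t)"
  unfolding W_power2 by (simp add: power2_eq_square algebra_simps)

lemma W_power2_sin: "(W t)\<^sup>2 = b\<^sup>2 + c\<^sup>2 * (sin t)\<^sup>2"
  unfolding W_power2 by (simp add: c_power2 sin_squared_eq algebra_simps)

lemma f_W: "f t = b * (a - c * cos t) / W t"
  by (simp add: f W_def)

lemma g_W: "g = (\<lambda>t. (LBINT z=ereal t0..ereal t. W z) - c * sin t * (a - c * cos t) / W t)"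
  by (simp add: g W_def)

lemma h_W: "h t = a * b / (W t * (a + c * cos t))"
  by (simp add: h W_def)

lemma h_pos: "h t > 0"
  using a_pos b_pos W_pos plus_pos by (simp add: h_W)

lemma W_deriv: "(W has_real_derivative c\<^sup>2 * cos t * sin t / W t) (at t)"
proof -
  let ?q = "\<lambda>t. a\<^sup>2 - c\<^sup>2 * (cos t)\<^sup>2"
  have q: "(?q has_real_derivative 2 * (c\<^sup>2 * cos t * sin t)) (at t)"
    by (auto intro!: derivative_eq_intros)
  have "?q t > 0"
    using W_pos[of t] by (simp add: W_def)
  from DERIV_chain2[where f = sqrt and g = ?q, OF DERIV_real_sqrt[OF this] q] show ?thesis
    by (simp add: W_def[abs_def] inverse_eq_divide mult_ac)
qed

lemma W_continuous: "continuous_on S W"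
  by (rule DERIV_continuous_on[OF has_field_derivative_at_within[OF W_deriv]])

lemma f_deriv: "(f has_real_derivative c * sin t * h t) (at t)"
proof -
  have "f = (\<lambda>t. b * (a - c * cos t) / W t)"
    by (auto simp: f_W)
  moreover have "((\<lambda>t. b * (a - c * cos t) / W t) has_real_derivative
      (b * (c * sin t) * W t - b * (a - c * cos t) * (c\<^sup>2 * cos t * sin t / W t)) / (W t * W t)) (at t)"
    using W_pos[of t] by (auto intro!: derivative_eq_intros W_deriv)
  \<comment> \<open>With \<open>q = c * cos t\<close>, the numerator contains
    \<open>W^2 - (a - q) * q = a * (a - q)\<close>, and \<open>a - q\<close> cancels against
    \<open>W^2 = (a - q) * (a + q)\<close>.\<close>
  moreover have "(b * (c * sin t) * W t - b * (a - c * cos t) * (c\<^sup>2 * cos t * sin t / W t)) / (W t * W t)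
      = c * sin t * h t"
    using W_pos[of t] plus_pos[of t] W_power2[of t]
    by (simp add: h_W divide_simps) algebra
  ultimately show ?thesis by simp
qed

lemma arc_deriv: "((\<lambda>t. LBINT z=ereal t0..ereal t. W z) has_real_derivative W t) (at t)"
proof -
  \<comment> \<open>The margin 1 puts \<open>t\<close> in the interior of an interval containing
    \<open>t0\<close>, on either side of it, so that the derivative within the interval is the full
    derivative.\<close>
  define l u where "l = min t0 t - 1" and "u = max t0 t + 1"
  have "((\<lambda>t. LBINT z=ereal t0..ereal t. W z) has_vector_derivative W t) (at t within {l..u})"
    by (rule interval_integral_FTC2) (auto simp: l_def u_def intro: W_continuous)
  moreover have "at t within {l..u} = at t"
    by (rule at_within_interior) (auto simp: l_def u_def)
  ultimately show ?thesis
    by (simp add: has_real_derivative_iff_has_vector_derivative)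
qed

lemma g_deriv: "(g has_real_derivative b * h t) (at t)"
proof -
  let ?D = "W t - ((c * cos t * (a - c * cos t) + c * sin t * (c * sin t)) * W t -
      c * sin t * (a - c * cos t) * (c\<^sup>2 * cos t * sin t / W t)) / (W t * W t)"
  have "(g has_real_derivative ?D) (at t)"
    unfolding g_W using W_pos[of t]
    by (auto intro!: derivative_eq_intros W_deriv arc_deriv)
  moreover have "?D = b * h t"
  proof -
    have "?D = (W t ^ 4 - (c * cos t * (a - c * cos t) + (c * sin t)\<^sup>2) * (W t)\<^sup>2 +
        (c * sin t)\<^sup>2 * (a - c * cos t) * (c * cos t)) / W t ^ 3"
      using W_pos[of t] by (simp add: field_simps power2_eq_square power3_eq_cube power4_eq_xxxx)
    also have "W t ^ 4 = ((W t)\<^sup>2)\<^sup>2"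
      by simp
    \<comment> \<open>With the sine eliminated and \<open>W^2\<close> factored, the numerator
      becomes a polynomial in \<open>a\<close>, \<open>b\<close> and \<open>q = c * cos t\<close>.
      It collapses to
      \<open>b^2 * (a^2 - q^2) - b^2 * q * (a - q) = a * b^2 * (a - q)\<close>.\<close>
    also have "(c * sin t)\<^sup>2 = a\<^sup>2 - b\<^sup>2 - (c * cos t)\<^sup>2"
      by (simp add: power_mult_distrib sin_squared_eq c_power2 algebra_simps)
    also have "((W t)\<^sup>2)\<^sup>2 - (c * cos t * (a - c * cos t) + (a\<^sup>2 - b\<^sup>2 - (c * cos t)\<^sup>2)) * (W t)\<^sup>2 +
        (a\<^sup>2 - b\<^sup>2 - (c * cos t)\<^sup>2) * (a - c * cos t) * (c * cos t) = a * b\<^sup>2 * (a - c * cos t)"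
      unfolding W_factor by algebra
    also have "a * b\<^sup>2 * (a - c * cos t) / W t ^ 3 = a * b\<^sup>2 * (a - c * cos t) / (W t * (W t)\<^sup>2)"
      by (simp add: power3_eq_cube power2_eq_square)
    also have "\<dots> = b * h t"
      unfolding W_factor h_W using minus_pos[of t] by (simp add: power2_eq_square)
    finally show ?thesis .
  qed
  ultimately show ?thesis by simp
qed

lemma h_deriv: "(h has_real_derivative deriv h t) (at t)"
proof -
  have "h = (\<lambda>t. a * b / (W t * (a + c * cos t)))"
    by (auto simp: h_W)
  moreover have "W field_differentiable at t"
    using W_deriv field_differentiable_def by blast
  moreover have "cos field_differentiable at t"
    by (rule field_differentiable_within_cos)
  ultimately have "h field_differentiable at t"
    using W_pos[of t] plus_pos[of t]
    by (auto intro!: derivative_intros field_differentiable_divide field_differentiable_mult)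
  then show ?thesis
    by (simp add: field_differentiable_derivI)
qed

text \<open>Uses the form \<open>b^2 + c^2 * sin^2 t\<close> of \<open>W^2\<close>; it makes the
  square root in \<open>speed\<close> explicit.\<close>

lemma speed_eq: "(c * sin t * h t)\<^sup>2 + (b * h t)\<^sup>2 = (h t * W t)\<^sup>2"
  by (simp add: power_mult_distrib W_power2_sin algebra_simps)

text \<open>
  The derivative of \<open>h\<close> cancels in \<open>f' g'' - f'' g'\<close>, so its explicit form is never required.
\<close>

sublocale revolution f g "\<lambda>t. c * sin t * h t" "\<lambda>t. b * h t"
  "\<lambda>t. c * cos t * h t + c * sin t * deriv h t" "\<lambda>t. b * deriv h t"
proof
  fix t
  show "f t > 0"
    using b_pos minus_pos W_pos by (simp add: f_W)
  show "(c * sin t * h t)\<^sup>2 + (b * h t)\<^sup>2 > 0"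
    unfolding speed_eq using h_pos[of t] W_pos[of t] by simp
  show "((\<lambda>t. c * sin t * h t) has_real_derivative c * cos t * h t + c * sin t * deriv h t) (at t)"
    by (auto intro!: derivative_eq_intros h_deriv simp: algebra_simps)
  show "((\<lambda>t. b * h t) has_real_derivative b * deriv h t) (at t)"
    by (auto intro!: derivative_eq_intros h_deriv)
qed (fact f_deriv g_deriv)+

lemma speed: "speed t = h t * W t"
  unfolding speed_def speed_eq using h_pos[of t] W_pos[of t] by simp

lemma speed_explicit: "speed t = a * b / (a + c * cos t)"
  unfolding speed using W_pos[of t] by (simp add: h_W)

section \<open>Fundamental forms and curvatures of the unduloid\<close>

lemma unit_normal_unduloid:
  "unit_normal X t v = (1 / W t) *\<^sub>R vector [- b * cos v, - b * sin v, c * sin t]"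
  using h_pos[of t] by (simp add: unit_normal speed scaleR_vector_3)

lemma f_power2: "(f t)\<^sup>2 = b\<^sup>2 * (a - c * cos t) / (a + c * cos t)"
  unfolding f_W power_divide W_factor using minus_pos[of t] by (simp add: power2_eq_square)

lemma coeff_L_unduloid:
  "coeff_L X t v = - a * b\<^sup>2 * c * cos t / ((a\<^sup>2 - c\<^sup>2 * (cos t)\<^sup>2) * (a + c * cos t))"
proof -
  have "coeff_L X t v = - b * c * cos t * h t * h t / (h t * W t)"
    unfolding coeff_L speed by (simp add: algebra_simps)
  also have "\<dots> = - b * c * cos t * h t / W t"
    using h_pos[of t] by simp
  also have "\<dots> = - a * b\<^sup>2 * c * cos t / ((W t)\<^sup>2 * (a + c * cos t))"
    by (simp add: h_W power2_eq_square mult_ac)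
  finally show ?thesis
    by (simp add: W_power2)
qed

lemma coeff_N_unduloid: "coeff_N X t v = b\<^sup>2 / (a + c * cos t)"
proof -
  have "coeff_N X t v = b\<^sup>2 * (a - c * cos t) / (W t)\<^sup>2"
    using h_pos[of t] by (simp add: coeff_N speed f_W power2_eq_square)
  then show ?thesis
    using minus_pos[of t] by (simp add: W_factor)
qed

lemma principal_curvature1_unduloid:
  "principal_curvature1 X t v = - c * cos t / (a * (a - c * cos t))"
proof -
  \<comment> \<open>\<open>W^2\<close> is split into its two factors so that
    \<open>(a + c * cos t)^2\<close> cancels against E.\<close>
  have "principal_curvature1 X t v =
      (- a * b\<^sup>2 * c * cos t / ((a - c * cos t) * (a + c * cos t) * (a + c * cos t))) /
      (a * b / (a + c * cos t))\<^sup>2"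
    by (simp add: principal_curvature1_def coeff_L_unduloid coeff_E speed_explicit
        flip: W_power2 W_factor)
  then show ?thesis
    using a_pos b_pos minus_pos[of t] plus_pos[of t]
    by (simp add: divide_simps power2_eq_square) (simp only: mult_ac)
qed

lemma principal_curvature2_unduloid: "principal_curvature2 X t v = 1 / (a - c * cos t)"
  using b_pos minus_pos[of t] plus_pos[of t]
  by (simp add: principal_curvature2_def coeff_N_unduloid coeff_G f_power2)

text \<open>Over the common denominator \<open>a * (a - c * cos t)\<close>, the numerator of the sum
  of the principal curvatures is \<open>a - c * cos t\<close>, so the dependence on \<open>t\<close>
  cancels.\<close>

lemma mean_curvature_unduloid: "mean_curvature X t v = 1 / (2 * a)"
proof -
  have "mean_curvature X t v = ((a - c * cos t) / (a * (a - c * cos t))) / 2"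
    using a_pos
    by (simp add: mean_curvature_def principal_curvature1_unduloid principal_curvature2_unduloid
        diff_divide_distrib)
  then show ?thesis
    using minus_pos[of t] by simp
qed

lemma gaussian_curvature_unduloid:
  "gaussian_curvature X t v = - c * cos t / (a * (a - c * cos t)\<^sup>2)"
proof -
  have "gaussian_curvature X t v = principal_curvature1 X t v * principal_curvature2 X t v"
    by (simp add: gaussian_curvature_def principal_curvature1_def principal_curvature2_def)
  then show ?thesis
    by (simp add: principal_curvature1_unduloid principal_curvature2_unduloid power2_eq_square)
qed

lemma geodesic_curvature_unduloid:
  assumes "arc_length_reparam (X t) \<phi>"
  shows "geodesic_curvature X (\<lambda>_. t) \<phi> s = c * sin t / (b * (a - c * cos t))"
  using h_pos[of t] W_pos[of t]
  by (simp add: geodesic_curvature_parallel[OF assms] speed f_W)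

section \<open>Total curvature of the unduloid\<close>

lemma curvature_density_unduloid:
  "curvature_density X p = - c * b\<^sup>2 * cos (fst p) / W (fst p) ^ 3"
proof -
  obtain t v where p: "p = (t, v)" by (cases p)
  have "curvature_density X (t, v) =
      (- c * cos t / (a * (a - c * cos t)\<^sup>2)) * (a * b / (a + c * cos t) * f t)"
    by (simp add: curvature_density_def gaussian_curvature_unduloid norm_d_t norm_d_v speed_explicit)
  also have "\<dots> = - c * b\<^sup>2 * cos t / ((a - c * cos t) * (a + c * cos t) * W t)"
    using a_pos minus_pos[of t] by (simp add: f_W power2_eq_square mult_ac)
  finally show ?thesis
    by (simp add: p power3_eq_cube flip: W_factor power2_eq_square)
qed

text \<open>The quotient rule leaves \<open>W^2 - c^2 * sin^2 t\<close> in the numerator, which is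
  the constant \<open>b^2\<close>.\<close>

lemma curvature_primitive:
  "((\<lambda>t. - c * (sin t / W t)) has_real_derivative - c * b\<^sup>2 * cos t / W t ^ 3) (at t)"
proof -
  let ?D = "- c * ((cos t * W t - sin t * (c\<^sup>2 * cos t * sin t / W t)) / (W t * W t))"
  have "((\<lambda>t. - c * (sin t / W t)) has_real_derivative ?D) (at t)"
    using W_pos[of t] by (intro DERIV_cmult DERIV_divide DERIV_sin W_deriv) simp
  moreover have "?D = - c * cos t * ((W t)\<^sup>2 - c\<^sup>2 * (sin t)\<^sup>2) / W t ^ 3"
    using W_pos[of t] by (simp add: right_diff_distrib left_diff_distrib diff_divide_distrib
        power2_eq_square power3_eq_cube mult_ac)
  ultimately show ?thesis
    by (simp add: W_power2_sin mult_ac)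
qed

lemma total_curvature_unduloid:
  assumes "t1 \<le> t2" "v1 \<le> v2"
  shows "set_integrable lborel ({t1..t2} \<times> {v1..v2}) (curvature_density X)"
    and "total_curvature X ({t1..t2} \<times> {v1..v2}) =
      - c * (v2 - v1) * (sin t2 / W t2 - sin t1 / W t1)"
proof -
  have density: "curvature_density X = (\<lambda>p. - c * b\<^sup>2 * cos (fst p) / W (fst p) ^ 3)"
    using curvature_density_unduloid by blast
  have cont: "continuous_on UNIV (\<lambda>t. - c * b\<^sup>2 * cos t / W t ^ 3)"
    using W_pos by (auto intro!: continuous_intros W_continuous simp: less_imp_neq[symmetric])
  note strip = set_integral_strip[OF curvature_primitive cont assms]
  show "set_integrable lborel ({t1..t2} \<times> {v1..v2}) (curvature_density X)"
    unfolding density by (rule strip(1))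
  show "total_curvature X ({t1..t2} \<times> {v1..v2}) =
      - c * (v2 - v1) * (sin t2 / W t2 - sin t1 / W t1)"
    unfolding total_curvature_def density strip(2) by algebra
qed

end

section \<open>Vertices of the ellipse and the final assembly\<close>

lemma ellipse_vertices_eq:
  assumes "a > 0"
  shows "ellipse_vertices a b = {(a, 0), (- a, 0)}"
proof -
  have "a\<^sup>2 \<noteq> 0"
    using assms by simp
  then have axis: "p\<^sup>2 / a\<^sup>2 = 1 \<longleftrightarrow> p = a \<or> p = - a" for p
    unfolding divide_eq_1_iff power2_eq_iff by blast
  have "ellipse_vertices a b = {P. (fst P)\<^sup>2 / a\<^sup>2 = 1 \<and> snd P = 0}"
    by (auto simp: ellipse_vertices_def ellipse_def)
  also have "\<dots> = {(a, 0), (- a, 0)}"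
    unfolding axis by (auto simp: prod_eq_iff)
  finally show ?thesis .
qed

theorem mainTheorem5:
  fixes a b c t0 :: real and f g h :: "real \<Rightarrow> real" and y :: surface
  assumes "a > b" and "b > 0"
    and c: "c = sqrt (a\<^sup>2 - b\<^sup>2)"
    and f: "f = (\<lambda>t. b * (a - c * cos t) / sqrt (a\<^sup>2 - c\<^sup>2 * (cos t)\<^sup>2))"
    and g: "g = (\<lambda>t. (LBINT z=ereal t0..ereal t. sqrt (a\<^sup>2 - c\<^sup>2 * (cos z)\<^sup>2)) -
                     c * sin t * (a - c * cos t) / sqrt (a\<^sup>2 - c\<^sup>2 * (cos t)\<^sup>2))"
    and h: "h = (\<lambda>t. a * b / (sqrt (a\<^sup>2 - c\<^sup>2 * (cos t)\<^sup>2) * (a + c * cos t)))"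
    and y: "y = surface_of_revolution f g"
  shows
    "(\<forall>t. f t > 0) \<and>
     (\<forall>t v.
        ((\<lambda>s. y s v) has_vector_derivative
           vector [c * sin t * h t * cos v, c * sin t * h t * sin v, b * h t]) (at t) \<and>
        ((\<lambda>w. y t w) has_vector_derivative
           vector [- f t * sin v, f t * cos v, 0]) (at v) \<and>
        unit_normal y t v =
          (1 / sqrt (a\<^sup>2 - c\<^sup>2 * (cos t)\<^sup>2)) *\<^sub>R vector [- b * cos v, - b * sin v, c * sin t] \<and>
        coeff_E y t v = a\<^sup>2 * b\<^sup>2 / (a + c * cos t)\<^sup>2 \<and>
        coeff_F y t v = 0 \<and>
        coeff_G y t v = b\<^sup>2 * (a - c * cos t) / (a + c * cos t) \<and>
        coeff_L y t v =
          - a * b\<^sup>2 * c * cos t / ((a\<^sup>2 - c\<^sup>2 * (cos t)\<^sup>2) * (a + c * cos t)) \<and>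
        coeff_M y t v = 0 \<and>
        coeff_N y t v = b\<^sup>2 / (a + c * cos t) \<and>
        principal_curvature1 y t v = - c * cos t / (a * (a - c * cos t)) \<and>
        principal_curvature2 y t v = 1 / (a - c * cos t) \<and>
        mean_curvature y t v = 1 / (2 * a) \<and>
        gaussian_curvature y t v = - c * cos t / (a * (a - c * cos t)\<^sup>2)) \<and>
     (\<exists>P Q. P \<noteq> Q \<and> ellipse_vertices a b = {P, Q} \<and> dist P Q = 2 * a \<and>
        (\<forall>t v. mean_curvature y t v = 1 / dist P Q)) \<and>
     (\<forall>t. (\<exists>\<phi>. arc_length_reparam (y t) \<phi> \<and> surj \<phi>) \<and>
        (\<forall>\<phi> s. arc_length_reparam (y t) \<phi> \<longrightarrow>
           geodesic_curvature y (\<lambda>_. t) \<phi> s = c * sin t / (b * (a - c * cos t)))) \<and>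
     (\<forall>t1 t2 v1 v2. t1 < t2 \<and> v1 < v2 \<longrightarrow>
        set_integrable lborel ({t1..t2} \<times> {v1..v2}) (curvature_density y) \<and>
        total_curvature y ({t1..t2} \<times> {v1..v2}) =
          - c * (v2 - v1) * (sin t2 / sqrt (a\<^sup>2 - c\<^sup>2 * (cos t2)\<^sup>2) -
                             sin t1 / sqrt (a\<^sup>2 - c\<^sup>2 * (cos t1)\<^sup>2)))"
proof -
  interpret unduloid a b c t0 f g h
    by unfold_locales fact+
  have dist: "dist (a, 0 :: real) (- a, 0) = 2 * a"
    using a_pos by (simp add: dist_Pair_Pair dist_real_def real_sqrt_mult)
  show ?thesis
    unfolding y W_def[symmetric]
  proof (intro conjI allI impI)
    show "\<exists>P Q. P \<noteq> Q \<and> ellipse_vertices a b = {P, Q} \<and> dist P Q = 2 * a \<and>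
        (\<forall>t v. mean_curvature X t v = 1 / dist P Q)"
      \<comment> \<open>The witnesses are the endpoints of the major axis; their distance
        \<open>2 * a\<close> is the denominator of the mean curvature.\<close>
      by (rule exI[of _ "(a, 0)"], rule exI[of _ "(- a, 0)"])
        (use a_pos in \<open>simp add: dist ellipse_vertices_eq mean_curvature_unduloid\<close>)
    show "\<exists>\<phi>. arc_length_reparam (X t) \<phi> \<and> surj \<phi>" for t
      by (rule parallel_reparam_exists)
    show "((\<lambda>w. X t w) has_vector_derivative vector [- f t * sin v, f t * cos v, 0]) (at v)"
      for t v
      by (rule has_vector_derivative_v)
  qed (simp_all add: f_pos has_vector_derivative_t unit_normal_unduloid
      coeff_E speed_explicit power_divide power_mult_distrib coeff_F coeff_G f_power2
      coeff_L_unduloid W_power2 coeff_M coeff_N_unduloid principal_curvature1_unduloid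
      principal_curvature2_unduloid mean_curvature_unduloid gaussian_curvature_unduloid
      geodesic_curvature_unduloid total_curvature_unduloid)
qed

end
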